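(* The trilinear form on $\mathrm{Vect}\,S^1$ $$\beta_1(L,F,G)=\int_{S^1} l'(\varphi)\,\big(f'(\varphi)g''(\varphi)-f''(\varphi)g'(\varphi)\big)\,d\varphi,$$ where $L=l\frac{d}{d\varphi}$, $F=f\frac d{d\varphi}$, $G=g\frac d{d\varphi}$, is a continuous Leibniz $3$-cocycle on $\mathrm{Vect}\,S^1$ supported on the diagonal of $(S^1)^3$, i.e. $d\beta_1=0$ for the Leibniz coboundary.
   Context: $\mathrm{Vect}\,S^1$ is the Lie algebra of smooth vector fields on $S^1$ (coordinate $\varphi$), with bracket $[f\frac d{d\varphi},g\frac d{d\varphi}]=(fg'-f'g)\frac d{d\varphi}$. The Leibniz coboundary of a $3$-cochain $c$ is $dc(x_1,x_2,x_3,x_4)=\sum_{i<j}(-1)^{j+1}c(x_1,\dots,x_{i-1},[x_i,x_j],x_{i+1},\dots,\widehat{x_j},\dots,x_4)$. *)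

theory Defs
  imports "HOL-Analysis.Analysis"
begin

text \<open>A smooth vector field on the circle S^1 = R / 2 pi Z, in the coordinate phi,
  is represented by its coefficient function: a 2 pi-periodic real function
  all of whose iterated derivatives exist everywhere.\<close>
definition smooth_vf :: "(real \<Rightarrow> real) \<Rightarrow> bool" where
  "smooth_vf f \<longleftrightarrow> (\<forall>n x. ((deriv ^^ n) f) differentiable (at x))
                    \<and> (\<forall>x. f (x + 2 * pi) = f x)"

definition vf_bracket :: "(real \<Rightarrow> real) \<Rightarrow> (real \<Rightarrow> real) \<Rightarrow> (real \<Rightarrow> real)" where
  "vf_bracket f g = (\<lambda>x. f x * deriv g x - deriv f x * g x)"

text \<open>Leibniz coboundary of an n-cochain c (a function of a list of n arguments),
  evaluated on a list xs of n+1 arguments: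
  sum over i<j (1-based) of (-1)^(j+1) c(x_1,...,x_(i-1),[x_i,x_j],x_(i+1),...,hat x_j,...).
  Here indices are 0-based, so the sign (-1)^(j+1) becomes (-1)^j.\<close>
definition leibniz_cobound ::
  "('v \<Rightarrow> 'v \<Rightarrow> 'v) \<Rightarrow> ('v list \<Rightarrow> real) \<Rightarrow> 'v list \<Rightarrow> real" where
  "leibniz_cobound br c xs =
     (\<Sum>j<length xs. \<Sum>i<j. (-1) ^ j *
        c (take i xs @ [br (xs ! i) (xs ! j)] @ drop (Suc i) (take j xs) @ drop (Suc j) xs))"

definition beta1 :: "(real \<Rightarrow> real) list \<Rightarrow> real" where
  "beta1 xs = (let l = xs ! 0; f = xs ! 1; g = xs ! 2 in
     integral {0..2 * pi} (\<lambda>x. deriv l x *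
        (deriv f x * deriv (deriv g) x - deriv (deriv f) x * deriv g x)))"

end

theory Submission
  imports Defs
begin

text \<open>The coboundary commutes with the integral, and pointwise the integrand of
  \<open>d\<beta>\<^sub>1(l, f, g, h)\<close> is the derivative of \<open>l' W\<close>, where \<open>W\<close> is the Wronskian of
  \<open>f, g, h\<close>; the computation only uses \<open>[a, b]' = a b'' - a'' b\<close>. Since \<open>l' W\<close> is
  \<open>2\<pi>\<close>-periodic, its derivative integrates to zero over a period.\<close>

definition nth_deriv :: "nat \<Rightarrow> (real \<Rightarrow> real) \<Rightarrow> real \<Rightarrow> real" where
  "nth_deriv n f = (deriv ^^ n) f"

lemma nth_deriv_0 [simp]: "nth_deriv 0 f = f"
  by (simp add: nth_deriv_def)

lemma deriv_nth_deriv: "deriv (nth_deriv n f) = nth_deriv (Suc n) f"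
  by (simp add: nth_deriv_def)

lemma deriv_eq_nth_deriv: "deriv f = nth_deriv 1 f" "deriv (deriv f) = nth_deriv 2 f"
  by (simp_all add: nth_deriv_def numeral_eq_Suc)

lemma nth_deriv_periodic:
  assumes "\<And>x. f (x + T) = f x"
  shows "nth_deriv n f (x + T) = nth_deriv n f x"
proof -
  have "f \<circ> (\<lambda>y. x + T + y) = f \<circ> (\<lambda>y. x + y)"
    using assms[of "x + _"] by (auto simp: o_def add_ac)
  then show ?thesis
    unfolding nth_deriv_def by (metis higher_deriv_shift_0)
qed

lemma has_integral_derivative_periodic:
  fixes P p :: "real \<Rightarrow> real"
  assumes "\<And>x. (P has_real_derivative p x) (at x)" "P (a + T) = P a" "0 \<le> T"
  shows "(p has_integral 0) {a..a + T}"
  using fundamental_theorem_of_calculus[of a "a + T" P p] assms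
  by (auto simp: has_real_derivative_iff_has_vector_derivative intro: has_vector_derivative_at_within)

lemma smooth_vf_has_nth_deriv [derivative_intros]:
  assumes "smooth_vf f" "D = nth_deriv (Suc n) f x"
  shows "(nth_deriv n f has_real_derivative D) (at x within S)"
proof -
  have "nth_deriv n f differentiable (at x)"
    using assms(1) by (simp add: smooth_vf_def nth_deriv_def)
  then show ?thesis
    using assms(2) DERIV_deriv_iff_real_differentiable has_field_derivative_at_within
    by (fastforce simp flip: deriv_nth_deriv)
qed

lemma smooth_vf_has_deriv [derivative_intros]:
  assumes "smooth_vf f" "D = nth_deriv 1 f x"
  shows "(f has_real_derivative D) (at x within S)"
  using smooth_vf_has_nth_deriv[OF assms(1), of D 0] assms(2) by simp

lemma continuous_on_nth_deriv:
  assumes "smooth_vf f"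
  shows "continuous_on S (nth_deriv n f)"
  using smooth_vf_has_nth_deriv[OF assms refl]
  by (meson DERIV_isCont continuous_at_imp_continuous_on)

lemma continuous_on_smooth_vf:
  assumes "smooth_vf f"
  shows "continuous_on S f"
  using continuous_on_nth_deriv[OF assms, of S 0] by simp

lemma vf_bracket_eq: "vf_bracket a b = (\<lambda>x. a x * nth_deriv 1 b x - nth_deriv 1 a x * b x)"
  by (simp add: vf_bracket_def deriv_eq_nth_deriv)

lemma nth_deriv_1_vf_bracket:
  assumes "smooth_vf a" "smooth_vf b"
  shows "nth_deriv 1 (vf_bracket a b) = (\<lambda>x. a x * nth_deriv 2 b x - nth_deriv 2 a x * b x)"
proof
  fix x
  have "(vf_bracket a b has_real_derivative a x * nth_deriv 2 b x - nth_deriv 2 a x * b x) (at x)"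
    unfolding vf_bracket_eq
    by (rule derivative_eq_intros refl assms | simp add: numeral_eq_Suc)+
  then show "nth_deriv 1 (vf_bracket a b) x = a x * nth_deriv 2 b x - nth_deriv 2 a x * b x"
    using DERIV_imp_deriv deriv_eq_nth_deriv(1) by metis
qed

lemma nth_deriv_2_vf_bracket:
  assumes "smooth_vf a" "smooth_vf b"
  shows "nth_deriv 2 (vf_bracket a b) = (\<lambda>x. nth_deriv 1 a x * nth_deriv 2 b x + a x * nth_deriv 3 b x
      - nth_deriv 3 a x * b x - nth_deriv 2 a x * nth_deriv 1 b x)"
proof
  fix x
  have "(nth_deriv 1 (vf_bracket a b) has_real_derivative nth_deriv 1 a x * nth_deriv 2 b x
      + a x * nth_deriv 3 b x - nth_deriv 3 a x * b x - nth_deriv 2 a x * nth_deriv 1 b x) (at x)"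
    unfolding nth_deriv_1_vf_bracket[OF assms]
    by (rule derivative_eq_intros refl assms | simp add: numeral_eq_Suc)+
  then show "nth_deriv 2 (vf_bracket a b) x = nth_deriv 1 a x * nth_deriv 2 b x
      + a x * nth_deriv 3 b x - nth_deriv 3 a x * b x - nth_deriv 2 a x * nth_deriv 1 b x"
    using DERIV_imp_deriv deriv_nth_deriv[of 1] by (metis numeral_2_eq_2 One_nat_def)
qed

lemma continuous_on_nth_deriv_vf_bracket [continuous_intros]:
  assumes "smooth_vf a" "smooth_vf b" "n \<in> {1, 2}"
  shows "continuous_on S (nth_deriv n (vf_bracket a b))"
  using assms by (auto simp del: One_nat_def simp: nth_deriv_1_vf_bracket nth_deriv_2_vf_bracket
    intro!: continuous_intros intro: continuous_on_nth_deriv continuous_on_smooth_vf)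

lemma leibniz_cobound_length_4:
  "leibniz_cobound br c [x1, x2, x3, x4] =
     - c [br x1 x2, x3, x4] + c [br x1 x3, x2, x4] + c [x1, br x2 x3, x4]
     - c [br x1 x4, x2, x3] - c [x1, br x2 x4, x3] - c [x1, x2, br x3 x4]"
  by (simp add: leibniz_cobound_def numeral_eq_Suc lessThan_Suc)

definition leibniz_face :: "('v \<Rightarrow> 'v \<Rightarrow> 'v) \<Rightarrow> 'v list \<Rightarrow> nat \<Rightarrow> nat \<Rightarrow> 'v list" where
  "leibniz_face br xs i j = take i xs @ [br (xs ! i) (xs ! j)] @ drop (Suc i) (take j xs) @ drop (Suc j) xs"

lemma leibniz_cobound_eq_sum_faces:
  "leibniz_cobound br c xs = (\<Sum>j<length xs. \<Sum>i<j. (-1) ^ j * c (leibniz_face br xs i j))"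
  by (simp add: leibniz_cobound_def leibniz_face_def)

lemma leibniz_cobound_integral:
  fixes d :: "'v list \<Rightarrow> 'a::euclidean_space \<Rightarrow> real"
  assumes "\<And>j i. i < j \<Longrightarrow> j < length xs \<Longrightarrow> d (leibniz_face br xs i j) integrable_on S"
  shows "leibniz_cobound br (\<lambda>ys. integral S (d ys)) xs =
         integral S (\<lambda>x. leibniz_cobound br (\<lambda>ys. d ys x) xs)"
proof -
  let ?F = "\<lambda>j x. \<Sum>i<j. (-1) ^ j * d (leibniz_face br xs i j) x"
  have term_integrable: "(\<lambda>x. (-1) ^ j * d (leibniz_face br xs i j) x) integrable_on S"
    if "i < j" "j < length xs" for i j
    using assms[OF that] by simp
  have inner_integrable: "?F j integrable_on S" if "j < length xs" for j
    using term_integrable that by (intro integrable_sum) auto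
  have inner: "integral S (?F j) = (\<Sum>i<j. (-1) ^ j * integral S (d (leibniz_face br xs i j)))"
    if "j < length xs" for j
    using term_integrable that by (subst integral_sum) auto
  have "integral S (\<lambda>x. \<Sum>j<length xs. ?F j x) = (\<Sum>j<length xs. integral S (?F j))"
    using inner_integrable by (subst integral_sum) auto
  also have "\<dots> = (\<Sum>j<length xs. \<Sum>i<j. (-1) ^ j * integral S (d (leibniz_face br xs i j)))"
    using inner by simp
  finally show ?thesis
    unfolding leibniz_cobound_eq_sum_faces by simp
qed

definition beta1_density :: "(real \<Rightarrow> real) list \<Rightarrow> real \<Rightarrow> real" where
  "beta1_density xs x = (let l = xs ! 0; f = xs ! 1; g = xs ! 2 in
     nth_deriv 1 l x * (nth_deriv 1 f x * nth_deriv 2 g x - nth_deriv 2 f x * nth_deriv 1 g x))"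

lemma beta1_eq_integral_density: "beta1 = (\<lambda>xs. integral {0..2 * pi} (beta1_density xs))"
  unfolding beta1_def beta1_density_def deriv_eq_nth_deriv(2)
  by (simp del: One_nat_def add: deriv_eq_nth_deriv(1) fun_eq_iff Let_def)

lemma continuous_on_beta1_density [continuous_intros]:
  assumes "continuous_on S (nth_deriv 1 l)"
    and "continuous_on S (nth_deriv 1 f)" "continuous_on S (nth_deriv 2 f)"
    and "continuous_on S (nth_deriv 1 g)" "continuous_on S (nth_deriv 2 g)"
  shows "continuous_on S (beta1_density [l, f, g])"
  unfolding beta1_density_def using assms by (auto intro!: continuous_intros)

text \<open>The determinant whose rows are the derivatives of orders \<open>0, m, n\<close> of \<open>(f, g, h)\<close>;
  \<open>jet_det 1 2\<close> is the Wronskian.\<close>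
definition jet_det :: "nat \<Rightarrow> nat \<Rightarrow> (real \<Rightarrow> real) \<Rightarrow> (real \<Rightarrow> real) \<Rightarrow> (real \<Rightarrow> real) \<Rightarrow> real \<Rightarrow> real"
  where
  "jet_det m n f g h x =
       f x * (nth_deriv m g x * nth_deriv n h x - nth_deriv n g x * nth_deriv m h x)
     - g x * (nth_deriv m f x * nth_deriv n h x - nth_deriv n f x * nth_deriv m h x)
     + h x * (nth_deriv m f x * nth_deriv n g x - nth_deriv n f x * nth_deriv m g x)"

lemma has_real_derivative_wronskian:
  assumes "smooth_vf f" "smooth_vf g" "smooth_vf h"
  shows "(jet_det 1 2 f g h has_real_derivative jet_det 1 3 f g h x) (at x)"
  unfolding jet_det_def[abs_def]
  by (rule derivative_eq_intros refl assms | simp add: numeral_eq_Suc)+ (simp add: algebra_simps)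

text \<open>In the coboundary the terms containing \<open>l\<close> itself cancel (a determinant with a repeated
  row), those with \<open>l''\<close> add up to \<open>l'' W\<close> and those with \<open>l'\<close> to \<open>l' W'\<close>, where
  \<open>W\<close> is the Wronskian of \<open>f, g, h\<close>.\<close>
lemma has_real_derivative_leibniz_cobound_beta1_density:
  assumes "smooth_vf l" "smooth_vf f" "smooth_vf g" "smooth_vf h"
  shows "((\<lambda>x. nth_deriv 1 l x * jet_det 1 2 f g h x) has_real_derivative
      leibniz_cobound vf_bracket (\<lambda>xs. beta1_density xs x) [l, f, g, h]) (at x)"
proof -
  have "((\<lambda>x. nth_deriv 1 l x * jet_det 1 2 f g h x) has_real_derivative
      nth_deriv 2 l x * jet_det 1 2 f g h x + nth_deriv 1 l x * jet_det 1 3 f g h x) (at x)"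
    by (rule derivative_eq_intros has_real_derivative_wronskian refl assms | simp add: numeral_eq_Suc)+
  moreover have "nth_deriv 2 l x * jet_det 1 2 f g h x + nth_deriv 1 l x * jet_det 1 3 f g h x
      = leibniz_cobound vf_bracket (\<lambda>xs. beta1_density xs x) [l, f, g, h]"
    unfolding leibniz_cobound_length_4
    by (simp del: One_nat_def
        add: beta1_density_def jet_det_def nth_deriv_1_vf_bracket nth_deriv_2_vf_bracket assms)
       (simp add: algebra_simps)
  ultimately show ?thesis by simp
qed

theorem mainTheorem5:
  fixes l f g h :: "real \<Rightarrow> real"
  assumes "smooth_vf l" and "smooth_vf f" and "smooth_vf g" and "smooth_vf h"
  shows "leibniz_cobound vf_bracket beta1 [l, f, g, h] = 0"
proof -
  let ?P = "\<lambda>x. nth_deriv 1 l x * jet_det 1 2 f g h x"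
  have periodic: "\<And>x. u (x + 2 * pi) = u x" if "smooth_vf u" for u
    using that by (simp add: smooth_vf_def)
  have "?P (0 + 2 * pi) = ?P 0"
    unfolding jet_det_def by (simp only: nth_deriv_periodic periodic assms)
  then have "((\<lambda>x. leibniz_cobound vf_bracket (\<lambda>xs. beta1_density xs x) [l, f, g, h])
      has_integral 0) {0..0 + 2 * pi}"
    by (intro has_integral_derivative_periodic[of ?P]
        has_real_derivative_leibniz_cobound_beta1_density assms) simp_all
  moreover have "leibniz_cobound vf_bracket beta1 [l, f, g, h] =
      integral {0..2 * pi} (\<lambda>x. leibniz_cobound vf_bracket (\<lambda>xs. beta1_density xs x) [l, f, g, h])"
    unfolding beta1_eq_integral_density
    by (rule leibniz_cobound_integral)
       (auto simp: less_Suc_eq numeral_eq_Suc leibniz_face_def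
         intro!: integrable_continuous_interval continuous_intros assms
           assms[THEN continuous_on_nth_deriv])
  ultimately show ?thesis
    by (simp add: integral_unique)
qed

end
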